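(* Let $k\ge 1$ and let $X$ be a finite $k$-dimensional simplicial complex with vertex set $V$. Let $A_0,A_1,\dots,A_k$ be a partition of $V$ into nonempty sets that attains the minimum in the definition of $h(X)$. Define \[ C(X) := \max\Bigl\{\sum_{v \in \tau^{\partial}} d(\tau^{\partial}\setminus\{v\}) : \tau^{\partial} \in F^{\partial}(A_0,A_1,\dots,A_k)\Bigr\}, \] where for a $(k-1)$-face $\sigma\in X_{k-1}$ we set $d(\sigma) := |\{\tau^{\partial} \in F^{\partial}(A_0,A_1,\dots,A_k): \sigma \subseteq \tau^{\partial}\}|$. Then \[ \lambda(X) \leq \frac{C(X)}{|V|}\, h(X). \] In particular, if there is $C$ such that every $(k-1)$-face $\sigma\in X_{k-1}$ is contained in at most $C$ $k$-faces of $K(X)$, i.e. $|\{\tau \in K(X)_k :\sigma \subseteq \tau \}| \leq C$ for all $\sigma\in X_{k-1}$, then $C(X) \leq (k+1) C$ and hence \[ \lambda(X) \leq \frac{(k+1)C}{|V|}\, h(X). \]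
   Context: A (finite abstract) simplicial complex $X$ on a finite vertex set $V$ is a family of subsets of $V$ closed under taking subsets; $X_i$ denotes its set of $i$-faces (faces with $i+1$ elements), and $X$ is $k$-dimensional if its largest face has $k+1$ elements. Fix a linear order on $V$; an $i$-face $\tau=\{v_0<\dots<v_i\}$ gets oriented incidence numbers $[\tau:\sigma]=(-1)^j$ if $\sigma=\tau\setminus\{v_j\}$ and $[\tau:\sigma]=0$ if $\sigma\not\subseteq\tau$. Real cochains: $C^i=C^i(X;\mathbb{R})$ is the space of functions $X_i\to\mathbb{R}$ with inner product $\langle f,g\rangle=\sum_{\tau\in X_i}f(\tau)g(\tau)$; the coboundary $\delta_i:C^i\to C^{i+1}$ is $\delta_i f(\tau)=\sum_{\sigma\in X_i}[\tau:\sigma]f(\sigma)$ (with $X_{-1}=\{\emptyset\}$). Let $\partial_{i+1}$ be the adjoint of $\delta_i$, $B^{k-1}=\operatorname{im}\delta_{k-2}$, $Z_{k-1}=\ker\partial_{k-1}=(B^{k-1})^\perp$, and the upper Laplacian $L^{\mathrm{up}}_{k-1}(X)=\partial_k\delta_{k-1}$ on $C^{k-1}$. The spectral gap $\lambda(X)$ is the smallest eigenvalue of $L^{\mathrm{up}}_{k-1}(X)$ restricted to $(B^{k-1})^\perp=Z_{k-1}$ (independent of the chosen order). The $k$-dimensional completion of $X$ is $K(X):=X\cup\{\tau\subseteq V: |\tau|=k+1,\ \tau\setminus\{v\}\in X \text{ for all } v\in\tau\}$. For a partition $V=A_0\sqcup\dots\sqcup A_k$, $F(A_0,\dots,A_k)$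 is the set of $k$-faces of $X$ with exactly one vertex in each $A_i$, and $F^{\partial}(A_0,\dots,A_k)$ is the set of $(k+1)$-element sets $\tau^\partial\in K(X)$ with $|\tau^\partial\cap A_i|=1$ for all $i$. The Cheeger constant is \[h(X):=\min_{V=\sqcup_{i=0}^k A_i,\ A_i\neq\emptyset}\frac{|V|\,|F(A_0,\dots,A_k)|}{|F^{\partial}(A_0,\dots,A_k)|},\] where a quotient with zero denominator is defined to be $\infty$. *)

theory Defs
  imports Complex_Main "HOL-Library.Extended_Real" "HOL-Library.Disjoint_Sets" "HOL-Library.FuncSet"
begin

definition abstract_complex :: "'a set \<Rightarrow> 'a set set \<Rightarrow> bool" where
  "abstract_complex V X \<longleftrightarrow>
     finite V \<and> (\<forall>\<tau>\<in>X. \<tau> \<subseteq> V) \<and> (\<forall>\<tau>\<in>X. \<forall>\<sigma>. \<sigma> \<subseteq> \<tau> \<longrightarrow> \<sigma> \<in> X)"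

definition k_dimensional :: "'a set set \<Rightarrow> nat \<Rightarrow> bool" where
  "k_dimensional X k \<longleftrightarrow> (\<exists>\<tau>\<in>X. card \<tau> = k + 1) \<and> (\<forall>\<tau>\<in>X. card \<tau> \<le> k + 1)"

text \<open>Dimensions are integers, so that the \<open>-1\<close>-face \<open>{}\<close> fits the general pattern.\<close>

definition ifaces :: "'a set set \<Rightarrow> int \<Rightarrow> 'a set set" where
  "ifaces X i = {\<tau> \<in> X. int (card \<tau>) = i + 1}"

text \<open>In \<open>\<tau> = {v\<^sub>0 < \<dots> < v\<^sub>i}\<close> the position \<open>j\<close> of the vertex \<open>v\<^sub>j\<close> is the number of
  vertices of \<open>\<tau>\<close> below it.\<close>

definition incidence :: "'a::linorder set \<Rightarrow> 'a set \<Rightarrow> real" where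
  "incidence \<tau> \<sigma> =
     (if \<exists>v\<in>\<tau>. \<sigma> = \<tau> - {v} then (- 1) ^ card {u \<in> \<tau>. u < the_elem (\<tau> - \<sigma>)} else 0)"

text \<open>A function on the \<open>i\<close>-faces is represented by its extension by zero to all sets.\<close>

definition cochains :: "'a set set \<Rightarrow> int \<Rightarrow> ('a set \<Rightarrow> real) set" where
  "cochains X i = {f. \<forall>\<sigma>. \<sigma> \<notin> ifaces X i \<longrightarrow> f \<sigma> = 0}"

definition cochain_inner ::
    "'a set set \<Rightarrow> int \<Rightarrow> ('a set \<Rightarrow> real) \<Rightarrow> ('a set \<Rightarrow> real) \<Rightarrow> real" where
  "cochain_inner X i f g = (\<Sum>\<tau>\<in>ifaces X i. f \<tau> * g \<tau>)"

definition coboundary ::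
    "'a::linorder set set \<Rightarrow> int \<Rightarrow> ('a set \<Rightarrow> real) \<Rightarrow> ('a set \<Rightarrow> real)" where
  "coboundary X i f =
     (\<lambda>\<tau>. if \<tau> \<in> ifaces X (i + 1) then \<Sum>\<sigma>\<in>ifaces X i. incidence \<tau> \<sigma> * f \<sigma> else 0)"

text \<open>The adjoint, from \<open>i\<close>-cochains to \<open>(i - 1)\<close>-cochains, of \<open>coboundary X (i - 1)\<close>; see
  \<open>boundary_adjoint\<close> and \<open>boundary_eq\<close> below.\<close>

definition boundary ::
    "'a::linorder set set \<Rightarrow> int \<Rightarrow> ('a set \<Rightarrow> real) \<Rightarrow> ('a set \<Rightarrow> real)" where
  "boundary X i g =
     (THE f. f \<in> cochains X (i - 1) \<and>
        (\<forall>h\<in>cochains X (i - 1).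
           cochain_inner X i (coboundary X (i - 1) h) g = cochain_inner X (i - 1) h f))"

definition coboundaries :: "'a::linorder set set \<Rightarrow> int \<Rightarrow> ('a set \<Rightarrow> real) set" where
  "coboundaries X i = coboundary X (i - 1) ` cochains X (i - 1)"

definition cycles :: "'a::linorder set set \<Rightarrow> int \<Rightarrow> ('a set \<Rightarrow> real) set" where
  "cycles X i = {f \<in> cochains X i. boundary X i f = (\<lambda>_. 0)}"

definition coboundaries_perp :: "'a::linorder set set \<Rightarrow> int \<Rightarrow> ('a set \<Rightarrow> real) set" where
  "coboundaries_perp X i =
     {f \<in> cochains X i. \<forall>b\<in>coboundaries X i. cochain_inner X i f b = 0}"

definition up_laplacian ::
    "'a::linorder set set \<Rightarrow> int \<Rightarrow> ('a set \<Rightarrow> real) \<Rightarrow> ('a set \<Rightarrow> real)" where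
  "up_laplacian X i f = boundary X (i + 1) (coboundary X i f)"

definition is_eigenvalue_on ::
    "('b \<Rightarrow> real) set \<Rightarrow> (('b \<Rightarrow> real) \<Rightarrow> ('b \<Rightarrow> real)) \<Rightarrow> real \<Rightarrow> bool" where
  "is_eigenvalue_on W L \<mu> \<longleftrightarrow> (\<exists>f\<in>W. f \<noteq> (\<lambda>_. 0) \<and> L f = (\<lambda>x. \<mu> * f x))"

definition spectral_gap :: "'a::linorder set set \<Rightarrow> nat \<Rightarrow> real" where
  "spectral_gap X k =
     (LEAST \<mu>. is_eigenvalue_on (coboundaries_perp X (int k - 1)) (up_laplacian X (int k - 1)) \<mu>)"

definition k_completion :: "'a set \<Rightarrow> 'a set set \<Rightarrow> nat \<Rightarrow> 'a set set" where
  "k_completion V X k = X \<union> {\<tau>. \<tau> \<subseteq> V \<and> card \<tau> = k + 1 \<and> (\<forall>v\<in>\<tau>. \<tau> - {v} \<in> X)}"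

definition nonempty_partition :: "'a set \<Rightarrow> nat \<Rightarrow> (nat \<Rightarrow> 'a set) \<Rightarrow> bool" where
  "nonempty_partition V k A \<longleftrightarrow>
     (\<Union>i\<le>k. A i) = V \<and> disjoint_family_on A {..k} \<and> (\<forall>i\<le>k. A i \<noteq> {})"

definition rainbow_faces :: "'a set set \<Rightarrow> nat \<Rightarrow> (nat \<Rightarrow> 'a set) \<Rightarrow> 'a set set" where
  "rainbow_faces X k A = {\<tau> \<in> ifaces X (int k). \<forall>i\<le>k. card (\<tau> \<inter> A i) = 1}"

definition rainbow_completion_faces ::
    "'a set \<Rightarrow> 'a set set \<Rightarrow> nat \<Rightarrow> (nat \<Rightarrow> 'a set) \<Rightarrow> 'a set set" where
  "rainbow_completion_faces V X k A =
     {\<tau> \<in> k_completion V X k. card \<tau> = k + 1 \<and> (\<forall>i\<le>k. card (\<tau> \<inter> A i) = 1)}"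

definition cheeger_quotient ::
    "'a set \<Rightarrow> 'a set set \<Rightarrow> nat \<Rightarrow> (nat \<Rightarrow> 'a set) \<Rightarrow> ereal" where
  "cheeger_quotient V X k A =
     (if card (rainbow_completion_faces V X k A) = 0 then \<infinity>
      else ereal (real (card V) * real (card (rainbow_faces X k A))
                  / real (card (rainbow_completion_faces V X k A))))"

definition cheeger_constant :: "'a set \<Rightarrow> 'a set set \<Rightarrow> nat \<Rightarrow> ereal" where
  "cheeger_constant V X k = Min (cheeger_quotient V X k ` {A. nonempty_partition V k A})"

definition rainbow_degree ::
    "'a set \<Rightarrow> 'a set set \<Rightarrow> nat \<Rightarrow> (nat \<Rightarrow> 'a set) \<Rightarrow> 'a set \<Rightarrow> nat" where
  "rainbow_degree V X k A \<sigma> = card {\<tau> \<in> rainbow_completion_faces V X k A. \<sigma> \<subseteq> \<tau>}"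

definition max_degree_sum ::
    "'a set \<Rightarrow> 'a set set \<Rightarrow> nat \<Rightarrow> (nat \<Rightarrow> 'a set) \<Rightarrow> nat" where
  "max_degree_sum V X k A =
     Max ((\<lambda>\<tau>. \<Sum>v\<in>\<tau>. rainbow_degree V X k A (\<tau> - {v})) ` rainbow_completion_faces V X k A)"

lemma abstract_complex_finite: "finite X" if "abstract_complex V X"
  using that unfolding abstract_complex_def by (meson Pow_iff finite_Pow_iff finite_subset subsetI)

lemma finite_ifaces: "finite (ifaces X i)" if "finite X"
  using that by (simp add: ifaces_def)

lemma coboundary_mem: "coboundary X i f \<in> cochains X (i + 1)"
  by (simp add: coboundary_def cochains_def)

lemma boundary_eq:
  fixes X :: "'a::linorder set set"
  assumes "finite X"
  shows "boundary X i g =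
    (\<lambda>\<sigma>. if \<sigma> \<in> ifaces X (i - 1) then \<Sum>\<tau>\<in>ifaces X i. incidence \<tau> \<sigma> * g \<tau> else 0)"
    (is "_ = ?f")
  unfolding boundary_def
proof (rule the_equality)
  have *: "cochain_inner X i (coboundary X (i - 1) h) g = cochain_inner X (i - 1) h ?f" for h
  proof -
    have "cochain_inner X i (coboundary X (i - 1) h) g =
        (\<Sum>\<tau>\<in>ifaces X i. \<Sum>\<sigma>\<in>ifaces X (i - 1). incidence \<tau> \<sigma> * h \<sigma> * g \<tau>)"
      by (simp add: cochain_inner_def coboundary_def sum_distrib_right)
    also have "\<dots> = (\<Sum>\<sigma>\<in>ifaces X (i - 1). \<Sum>\<tau>\<in>ifaces X i. incidence \<tau> \<sigma> * h \<sigma> * g \<tau>)"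
      by (rule sum.swap)
    also have "\<dots> = cochain_inner X (i - 1) h ?f"
      by (simp add: cochain_inner_def sum_distrib_left mult_ac)
    finally show ?thesis .
  qed
  then show "?f \<in> cochains X (i - 1) \<and>
     (\<forall>h\<in>cochains X (i - 1).
        cochain_inner X i (coboundary X (i - 1) h) g = cochain_inner X (i - 1) h ?f)"
    by (simp add: cochains_def)
  fix f
  assume f: "f \<in> cochains X (i - 1) \<and>
     (\<forall>h\<in>cochains X (i - 1).
        cochain_inner X i (coboundary X (i - 1) h) g = cochain_inner X (i - 1) h f)"
  show "f = ?f"
  proof
    fix \<sigma>
    show "f \<sigma> = ?f \<sigma>"
    proof (cases "\<sigma> \<in> ifaces X (i - 1)")
      case True
      define h :: "'a set \<Rightarrow> real" where "h = (\<lambda>\<rho>. if \<rho> = \<sigma> then 1 else 0)"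
      have ev: "cochain_inner X (i - 1) h u = u \<sigma>" for u
      proof -
        have "cochain_inner X (i - 1) h u =
            (\<Sum>\<tau>\<in>ifaces X (i - 1). if \<tau> = \<sigma> then u \<tau> else 0)"
          unfolding cochain_inner_def by (rule sum.cong) (auto simp: h_def)
        then show ?thesis
          using True finite_ifaces[OF assms, of "i - 1"] by simp
      qed
      have "h \<in> cochains X (i - 1)"
        using True by (auto simp: h_def cochains_def)
      then have "cochain_inner X (i - 1) h f = cochain_inner X (i - 1) h ?f"
        using f * by metis
      then show ?thesis
        unfolding ev .
    next
      case False
      then show ?thesis
        using f by (simp add: cochains_def)
    qed
  qed
qed

lemma boundary_adjoint:
  assumes "finite X"
  shows "cochain_inner X i (coboundary X (i - 1) h) g = cochain_inner X (i - 1) h (boundary X i g)"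
proof -
  have "cochain_inner X i (coboundary X (i - 1) h) g =
      (\<Sum>\<tau>\<in>ifaces X i. \<Sum>\<sigma>\<in>ifaces X (i - 1). incidence \<tau> \<sigma> * h \<sigma> * g \<tau>)"
    by (simp add: cochain_inner_def coboundary_def sum_distrib_right)
  also have "\<dots> = (\<Sum>\<sigma>\<in>ifaces X (i - 1). \<Sum>\<tau>\<in>ifaces X i. incidence \<tau> \<sigma> * h \<sigma> * g \<tau>)"
    by (rule sum.swap)
  also have "\<dots> = cochain_inner X (i - 1) h (boundary X i g)"
    by (simp add: boundary_eq[OF assms] cochain_inner_def sum_distrib_left mult_ac)
  finally show ?thesis .
qed

lemma boundary_mem: "boundary X i g \<in> cochains X (i - 1)" if "finite X"
  by (simp add: boundary_eq[OF that] cochains_def)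

lemma coboundaries_perp_eq_cycles:
  assumes "finite X"
  shows "coboundaries_perp X i = cycles X i"
proof -
  have "(\<forall>b\<in>coboundaries X i. cochain_inner X i f b = 0) \<longleftrightarrow> boundary X i f = (\<lambda>_. 0)" for f
  proof
    assume L: "\<forall>b\<in>coboundaries X i. cochain_inner X i f b = 0"
    let ?h = "boundary X i f"
    have h: "?h \<in> cochains X (i - 1)"
      by (rule boundary_mem[OF assms])
    then have "cochain_inner X i f (coboundary X (i - 1) ?h) = 0"
      using L by (simp add: coboundaries_def)
    then have "cochain_inner X (i - 1) ?h ?h = 0"
      using boundary_adjoint[OF assms, of i ?h f] by (simp add: cochain_inner_def mult.commute)
    then have "\<forall>\<sigma>\<in>ifaces X (i - 1). ?h \<sigma> = 0"
      using finite_ifaces[OF assms] by (simp add: cochain_inner_def sum_nonneg_eq_0_iff)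
    then show "?h = (\<lambda>_. 0)"
      using h by (auto simp: cochains_def)
  next
    assume R: "boundary X i f = (\<lambda>_. 0)"
    have "cochain_inner X i f (coboundary X (i - 1) h) = 0" for h
      using boundary_adjoint[OF assms, of i h f] R by (simp add: cochain_inner_def mult.commute)
    then show "\<forall>b\<in>coboundaries X i. cochain_inner X i f b = 0"
      by (auto simp: coboundaries_def)
  qed
  then show ?thesis
    by (simp add: coboundaries_perp_def cycles_def)
qed

lemma finite_cheeger_quotients:
  assumes "finite V"
  shows "finite (cheeger_quotient V X k ` {A. nonempty_partition V k A})"
proof (rule finite_subset)
  show "finite (cheeger_quotient V X k ` ({..k} \<rightarrow>\<^sub>E Pow V))"
    using assms by (intro finite_imageI finite_PiE) auto
  have "cheeger_quotient V X k A = cheeger_quotient V X k (restrict A {..k})" for A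
    by (simp add: cheeger_quotient_def rainbow_faces_def rainbow_completion_faces_def
        cong: conj_cong)
  moreover have "restrict A {..k} \<in> {..k} \<rightarrow>\<^sub>E Pow V" if "nonempty_partition V k A" for A
    using that by (auto simp: nonempty_partition_def)
  ultimately show "cheeger_quotient V X k ` {A. nonempty_partition V k A}
      \<subseteq> cheeger_quotient V X k ` ({..k} \<rightarrow>\<^sub>E Pow V)"
    by blast
qed

end

theory Submission
  imports Defs "HOL-Analysis.Convex" "HOL-Analysis.Function_Topology"
begin

text \<open>
  Colour each vertex by the index of its part, and let \<open>u\<close> be the \<open>(k - 1)\<close>-cochain that lives on
  the faces with colour set \<open>{1..k}\<close> and equals the sign of the permutation relating vertex order
  and colour order. On a \<open>k\<close>-face of any complex, \<open>\<delta> u\<close> is \<open>\<plusminus>1\<close> if the face is rainbow; otherwise it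
  is \<open>0\<close>, because the two facets obtained by deleting one of two equally coloured vertices cancel.

  Every cycle \<open>f\<close> satisfies \<open>\<lambda> \<langle>u, f\<rangle>\<^sup>2 \<le> \<parallel>\<delta> u\<parallel>\<^sup>2 \<parallel>f\<parallel>\<^sup>2\<close>: replacing \<open>u\<close> by a cycle \<open>u - \<delta> h\<close> changes
  neither \<open>\<delta> u\<close> nor \<open>\<langle>u, f\<rangle>\<close>, and for cycles this is the Rayleigh principle combined with
  Cauchy--Schwarz. The completion is a complex with the same \<open>(k - 1)\<close>-skeleton as \<open>X\<close>, so
  \<open>f = \<partial> \<delta> u\<close>, formed in the completion, is a cycle of \<open>X\<close>. Then \<open>\<parallel>\<delta> u\<parallel>\<^sup>2 = |F|\<close> in \<open>X\<close> and
  \<open>\<langle>u, f\<rangle> = |F\<^sup>\<partial>|\<close>, and since \<open>|f(\<sigma>)| \<le> d(\<sigma>)\<close>, double counting gives \<open>\<parallel>f\<parallel>\<^sup>2 \<le> C(X) |F\<^sup>\<partial>|\<close>.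
\<close>

section \<open>Inner products of functions on a finite set\<close>

definition inner_on :: "'b set \<Rightarrow> ('b \<Rightarrow> real) \<Rightarrow> ('b \<Rightarrow> real) \<Rightarrow> real" where
  "inner_on S f g = (\<Sum>x\<in>S. f x * g x)"

lemma inner_on_commute: "inner_on S f g = inner_on S g f"
  by (simp add: inner_on_def mult.commute)

lemma inner_on_linear_left:
  shows "inner_on S (\<lambda>x. f x + g x) h = inner_on S f h + inner_on S g h"
    and "inner_on S (\<lambda>x. f x - g x) h = inner_on S f h - inner_on S g h"
    and "inner_on S (\<lambda>x. t * f x) h = t * inner_on S f h"
  by (simp_all add: inner_on_def sum.distrib sum_subtractf sum_distrib_left algebra_simps)

lemma inner_on_sum_left:
  "inner_on S (\<lambda>x. \<Sum>i\<in>I. a i * b i x) h = (\<Sum>i\<in>I. a i * inner_on S (b i) h)"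
  unfolding inner_on_def sum_distrib_left sum_distrib_right
  by (subst sum.swap) (simp add: mult.assoc)

lemma inner_on_linear_right:
  shows "inner_on S h (\<lambda>x. f x + g x) = inner_on S h f + inner_on S h g"
    and "inner_on S h (\<lambda>x. f x - g x) = inner_on S h f - inner_on S h g"
    and "inner_on S h (\<lambda>x. t * f x) = t * inner_on S h f"
  by (simp_all only: inner_on_commute[of S h] inner_on_linear_left)

lemma inner_on_self_add_scaled:
  "inner_on S (\<lambda>x. f x + t * g x) (\<lambda>x. f x + t * g x)
   = inner_on S f f + 2 * t * inner_on S g f + t\<^sup>2 * inner_on S g g"
  unfolding inner_on_linear_left inner_on_linear_right
  by (simp add: inner_on_commute[of S f g] power2_eq_square algebra_simps)

lemma inner_on_self_nonneg: "0 \<le> inner_on S f f"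
  by (simp add: inner_on_def sum_nonneg)

lemma inner_on_self_eq_0_iff: "finite S \<Longrightarrow> inner_on S f f = 0 \<longleftrightarrow> (\<forall>x\<in>S. f x = 0)"
  by (simp add: inner_on_def sum_nonneg_eq_0_iff)

lemma inner_on_Cauchy_Schwarz: "(inner_on S f g)\<^sup>2 \<le> inner_on S f f * inner_on S g g"
  using Cauchy_Schwarz_ineq_sum[of f g S] by (simp add: inner_on_def power2_eq_square)

lemma inner_on_minus_projection:
  "inner_on S (\<lambda>x. r x - inner_on S r s / inner_on S s s * s x) s = 0"
  \<comment> \<open>If \<open>\<langle>s, s\<rangle> = 0\<close>, the coefficient is \<open>0\<close> by division by zero, and \<open>\<langle>r, s\<rangle> = 0\<close> as well.\<close>
  unfolding inner_on_linear_left using inner_on_Cauchy_Schwarz[of S r s] by auto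

lemma orthogonal_residual_exists:
  fixes b :: "'i \<Rightarrow> 'b \<Rightarrow> real"
  assumes "finite I"
  shows "\<exists>a. \<forall>j\<in>I. inner_on S (\<lambda>x. u x - (\<Sum>i\<in>I. a i * b i x)) (b j) = 0"
  using assms
proof (induction I arbitrary: u rule: finite_induct)
  case (insert m I)
  define residual where "residual u a x = u x - (\<Sum>i\<in>I. a i * b i x)" for u a and x :: 'b
  obtain a where a: "\<forall>j\<in>I. inner_on S (residual u a) (b j) = 0"
    using insert.IH unfolding residual_def by blast
  obtain a' where a': "\<forall>j\<in>I. inner_on S (residual (b m) a') (b j) = 0"
    using insert.IH unfolding residual_def by blast
  define r s where "r = residual u a" and "s = residual (b m) a'"
  define t where "t = inner_on S r s / inner_on S s s"
  define coeff where "coeff i = (if i = m then t else a i - t * a' i)" for i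
  have "(\<Sum>i\<in>I. coeff i * b i x) = (\<Sum>i\<in>I. a i * b i x) - t * (\<Sum>i\<in>I. a' i * b i x)" for x
  proof -
    have "(\<Sum>i\<in>I. coeff i * b i x) = (\<Sum>i\<in>I. (a i - t * a' i) * b i x)"
      using insert.hyps by (intro sum.cong) (auto simp: coeff_def)
    then show ?thesis
      by (simp add: sum_subtractf sum_distrib_left algebra_simps)
  qed
  moreover have "coeff m = t"
    by (simp add: coeff_def)
  ultimately have new_residual:
      "(\<lambda>x. u x - (\<Sum>i\<in>insert m I. coeff i * b i x)) = (\<lambda>x. r x - t * s x)"
    using insert.hyps by (simp add: r_def s_def residual_def right_diff_distrib fun_eq_iff)
  have orthogonal: "inner_on S (\<lambda>x. r x - t * s x) (b j) = 0" if "j \<in> I" for j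
    using that a a' by (simp add: inner_on_linear_left r_def s_def)
  have "inner_on S (\<lambda>x. r x - t * s x) s = 0"
    unfolding t_def by (rule inner_on_minus_projection)
  moreover have "b m = (\<lambda>x. s x + (\<Sum>i\<in>I. a' i * b i x))"
    by (simp add: s_def residual_def)
  ultimately have "inner_on S (\<lambda>x. r x - t * s x) (b m) = 0"
    using orthogonal
    by (simp add: inner_on_commute[of S "\<lambda>x. r x - t * s x"] inner_on_linear_left(1)
        inner_on_sum_left)
  then show ?case
    using orthogonal unfolding new_residual[symmetric] by blast
qed simp

section \<open>The least eigenvalue of a self-adjoint operator\<close>

lemma linear_coeff_eq_0_if_quadratic_nonneg:
  fixes b c :: real
  assumes "\<And>t. 0 \<le> 2 * t * b + t\<^sup>2 * c"
  shows "b = 0"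
proof -
  have "((\<lambda>t. 2 * t * b + t\<^sup>2 * c) has_real_derivative 2 * b) (at 0)"
    by (auto intro!: derivative_eq_intros)
  then have "2 * b = 0"
    by (rule DERIV_local_min[OF _ zero_less_one]) (simp add: assms)
  then show ?thesis by simp
qed

lemma continuous_on_eval [continuous_intros]:
  "continuous_on A (\<lambda>f :: 'b \<Rightarrow> real. f x)"
  by (rule continuous_on_subset[OF continuous_on_product_coordinates subset_UNIV])

lemma compact_if_closed_pointwise_bounded:
  fixes W :: "('b \<Rightarrow> real) set"
  assumes "closed W" "\<And>f x. f \<in> W \<Longrightarrow> \<bar>f x\<bar> \<le> r"
  shows "compact W"
proof -
  have "compact (PiE UNIV (\<lambda>_ :: 'b. {- r..r}))"
    using compactin_PiE[of "\<lambda>_. euclidean" UNIV "\<lambda>_ :: 'b. {- r..r}"]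
    by (simp add: euclidean_product_topology)
  moreover have "W = PiE UNIV (\<lambda>_ :: 'b. {- r..r}) \<inter> W"
    using assms(2) by (force simp: PiE_UNIV_domain abs_le_iff)
  ultimately show ?thesis
    using compact_Int_closed[OF _ assms(1)] by metis
qed

locale self_adjoint_operator =
  fixes S :: "'b set" and W :: "('b \<Rightarrow> real) set" and L :: "('b \<Rightarrow> real) \<Rightarrow> 'b \<Rightarrow> real"
  assumes finite_support: "finite S"
    and supported: "f \<in> W \<Longrightarrow> x \<notin> S \<Longrightarrow> f x = 0"
    and add_scaled_mem: "f \<in> W \<Longrightarrow> g \<in> W \<Longrightarrow> (\<lambda>x. f x + t * g x) \<in> W"
    and closed: "closed W"
    and operator_mem: "f \<in> W \<Longrightarrow> L f \<in> W"
    and self_adjoint: "f \<in> W \<Longrightarrow> g \<in> W \<Longrightarrow> inner_on S f (L g) = inner_on S (L f) g"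
    and continuous_operator: "continuous_on W (\<lambda>f. L f x)"
begin

lemma scaled_mem: "f \<in> W \<Longrightarrow> (\<lambda>x. t * f x) \<in> W"
  using add_scaled_mem[of f f "t - 1"] by (simp add: algebra_simps)

lemma inner_on_self_pos:
  assumes "f \<in> W" "f \<noteq> (\<lambda>_. 0)"
  shows "0 < inner_on S f f"
proof -
  have "inner_on S f f \<noteq> 0"
    using assms supported by (metis ext inner_on_self_eq_0_iff[OF finite_support])
  then show ?thesis
    using inner_on_self_nonneg[of S f] by simp
qed

lemma compact_unit_sphere: "compact {f \<in> W. inner_on S f f = 1}"
proof (rule compact_if_closed_pointwise_bounded)
  have "continuous_on UNIV (\<lambda>f. inner_on S f f)"
    unfolding inner_on_def by (intro continuous_intros)
  then show "closed {f \<in> W. inner_on S f f = 1}"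
    using closed closed_Collect_eq[OF _ continuous_on_const, of "\<lambda>f. inner_on S f f" 1]
    by (simp add: Collect_conj_eq closed_Int)
  show "\<bar>f x\<bar> \<le> 1" if f: "f \<in> {f \<in> W. inner_on S f f = 1}" for f x
  proof (cases "x \<in> S")
    case True
    then have "f x * f x \<le> inner_on S f f"
      unfolding inner_on_def using finite_support by (intro member_le_sum) auto
    then show ?thesis
      using f by (simp add: abs_square_le_1 flip: power2_eq_square)
  qed (use f supported[of f x] in auto)
qed

lemma inner_on_operator_scaled:
  assumes "f \<in> W"
  shows "inner_on S (\<lambda>x. t * f x) (L (\<lambda>x. t * f x)) = t\<^sup>2 * inner_on S f (L f)"
proof -
  have "inner_on S (\<lambda>x. t * f x) (L (\<lambda>x. t * f x)) = t * inner_on S f (L (\<lambda>x. t * f x))"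
    by (rule inner_on_linear_left)
  also have "\<dots> = t * (t * inner_on S (L f) f)"
    by (simp add: self_adjoint[OF assms scaled_mem[OF assms]] inner_on_linear_right)
  finally show ?thesis
    by (simp add: power2_eq_square inner_on_commute)
qed

lemma inner_on_operator_add_scaled:
  assumes "f \<in> W" "g \<in> W"
  shows "inner_on S (\<lambda>x. f x + t * g x) (L (\<lambda>x. f x + t * g x))
    = inner_on S f (L f) + 2 * t * inner_on S g (L f) + t\<^sup>2 * inner_on S g (L g)"
proof -
  let ?h = "\<lambda>x. f x + t * g x"
  have "inner_on S ?h (L ?h) = inner_on S (L f) ?h + t * inner_on S (L g) ?h"
    using assms by (simp add: inner_on_linear_left self_adjoint add_scaled_mem)
  also have "\<dots> = inner_on S f (L f) + t * inner_on S g (L f)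
      + t * (inner_on S f (L g) + t * inner_on S g (L g))"
    by (simp add: inner_on_linear_right inner_on_commute[of S "L _"])
  also have "inner_on S f (L g) = inner_on S g (L f)"
    unfolding self_adjoint[OF assms] by (rule inner_on_commute)
  finally show ?thesis
    by (simp add: power2_eq_square algebra_simps)
qed

lemma rayleigh_quotient_attains_min:
  assumes "f\<^sub>0 \<in> W" "f\<^sub>0 \<noteq> (\<lambda>_. 0)"
  obtains z where "z \<in> W" "inner_on S z z = 1"
    "\<And>f. f \<in> W \<Longrightarrow> inner_on S z (L z) * inner_on S f f \<le> inner_on S f (L f)"
proof -
  define D where "D = {f \<in> W. inner_on S f f = 1}"
  have normalized: "(\<lambda>x. 1 / sqrt (inner_on S f f) * f x) \<in> D"
    if "f \<in> W" "f \<noteq> (\<lambda>_. 0)" for f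
    using scaled_mem[OF that(1), of "1 / sqrt (inner_on S f f)"] inner_on_self_pos[OF that]
    unfolding D_def mem_Collect_eq inner_on_linear_left inner_on_linear_right by simp
  have "continuous_on W (\<lambda>f. inner_on S f (L f))"
    unfolding inner_on_def by (intro continuous_intros continuous_operator)
  then have "continuous_on D (\<lambda>f. inner_on S f (L f))"
    by (rule continuous_on_subset) (auto simp: D_def)
  moreover have "compact D" "D \<noteq> {}"
    using compact_unit_sphere normalized[OF assms] by (auto simp: D_def)
  ultimately obtain z
    where z: "z \<in> D" and min: "\<And>f. f \<in> D \<Longrightarrow> inner_on S z (L z) \<le> inner_on S f (L f)"
    using continuous_attains_inf[of D] by blast
  have "inner_on S z (L z) * inner_on S f f \<le> inner_on S f (L f)" if "f \<in> W" for f
  proof (cases "f = (\<lambda>_. 0)")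
    case False
    then have "0 < inner_on S f f"
      using inner_on_self_pos that by blast
    moreover have "inner_on S z (L z) \<le> (1 / sqrt (inner_on S f f))\<^sup>2 * inner_on S f (L f)"
      using min[OF normalized[OF that False]] by (simp only: inner_on_operator_scaled[OF that])
    ultimately show ?thesis
      by (simp add: power_divide field_simps)
  qed (simp add: inner_on_def)
  then show thesis
    using that[of z] z by (simp add: D_def)
qed

lemma eigenvector_if_rayleigh_quotient_minimal:
  assumes "z \<in> W" "inner_on S z (L z) = \<mu> * inner_on S z z"
    and min: "\<And>f. f \<in> W \<Longrightarrow> \<mu> * inner_on S f f \<le> inner_on S f (L f)"
  shows "L z = (\<lambda>x. \<mu> * z x)"
proof -
  define r where "r = (\<lambda>x. L z x - \<mu> * z x)"
  have r: "r \<in> W"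
    using add_scaled_mem[OF operator_mem[OF assms(1)] assms(1), of "- \<mu>"] by (simp add: r_def)
  have "inner_on S r (L z) - \<mu> * inner_on S r z = 0" (is "?b = 0")
  proof (rule linear_coeff_eq_0_if_quadratic_nonneg)
    fix t
    let ?y = "\<lambda>x. z x + t * r x"
    have "0 \<le> inner_on S ?y (L ?y) - \<mu> * inner_on S ?y ?y"
      using min[OF add_scaled_mem[OF assms(1) r]] by simp
    also have "\<dots> = 2 * t * ?b + t\<^sup>2 * (inner_on S r (L r) - \<mu> * inner_on S r r)"
      unfolding inner_on_operator_add_scaled[OF assms(1) r] inner_on_self_add_scaled assms(2)
      by (simp add: algebra_simps)
    finally show "0 \<le> \<dots>" .
  qed
  moreover have "inner_on S r r = ?b"
    by (subst (2) r_def) (simp only: inner_on_linear_right)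
  ultimately have "r = (\<lambda>_. 0)"
    using inner_on_self_pos[OF r] by (metis less_irrefl)
  then show ?thesis
    by (simp add: r_def fun_eq_iff)
qed

lemma least_eigenvalue_le_rayleigh_quotient:
  assumes "f \<in> W"
  shows "(LEAST \<mu>. is_eigenvalue_on W L \<mu>) * inner_on S f f \<le> inner_on S f (L f)"
proof (cases "f = (\<lambda>_. 0)")
  case False
  obtain z where z: "z \<in> W" "inner_on S z z = 1"
    and min: "\<And>f. f \<in> W \<Longrightarrow> inner_on S z (L z) * inner_on S f f \<le> inner_on S f (L f)"
    using rayleigh_quotient_attains_min[OF assms False] by blast
  have "(LEAST \<mu>. is_eigenvalue_on W L \<mu>) = inner_on S z (L z)"
  proof (rule Least_equality)
    have "L z = (\<lambda>x. inner_on S z (L z) * z x)"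
      using z min by (intro eigenvector_if_rayleigh_quotient_minimal) auto
    moreover have "z \<noteq> (\<lambda>_. 0)"
      using z(2) by (auto simp: inner_on_def)
    ultimately show "is_eigenvalue_on W L (inner_on S z (L z))"
      using z(1) unfolding is_eigenvalue_on_def by (intro bexI[of _ z] conjI)
  next
    fix \<mu>
    assume "is_eigenvalue_on W L \<mu>"
    then obtain g where g: "g \<in> W" "g \<noteq> (\<lambda>_. 0)" "L g = (\<lambda>x. \<mu> * g x)"
      by (auto simp: is_eigenvalue_on_def)
    then show "inner_on S z (L z) \<le> \<mu>"
      using min[OF g(1)] inner_on_self_pos[OF g(1,2)] by (simp add: inner_on_linear_right)
  qed
  then show ?thesis
    using min[OF assms] by (simp only:)
qed (simp add: inner_on_def)

end

section \<open>Cochains of a simplicial complex\<close>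

lemma cochain_inner_eq_inner_on: "cochain_inner X i = inner_on (ifaces X i)"
  by (simp add: fun_eq_iff cochain_inner_def inner_on_def)

definition vertex_sign :: "'a::linorder set \<Rightarrow> 'a \<Rightarrow> real" where
  "vertex_sign \<tau> v = (- 1) ^ card {u \<in> \<tau>. u < v}"

lemma abs_vertex_sign: "\<bar>vertex_sign \<tau> v\<bar> = 1"
  by (simp add: vertex_sign_def power_abs)

lemma vertex_sign_remove_self: "vertex_sign (\<tau> - {v}) v = vertex_sign \<tau> v"
  unfolding vertex_sign_def by (rule arg_cong[where f = "\<lambda>A. (- 1) ^ card A"]) auto

lemma vertex_sign_remove_swap:
  assumes "finite \<tau>" "v \<in> \<tau>" "w \<in> \<tau>" "v \<noteq> w"
  shows "vertex_sign \<tau> v * vertex_sign (\<tau> - {v}) w = - (vertex_sign \<tau> w * vertex_sign (\<tau> - {w}) v)"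
  using assms(2-4)
proof (induction v w rule: linorder_wlog)
  case (le v w)
  then have below_w: "{u \<in> \<tau>. u < w} = insert v {u \<in> \<tau> - {v}. u < w}"
    and below_v: "{u \<in> \<tau> - {w}. u < v} = {u \<in> \<tau>. u < v}"
    by auto
  show ?case
    unfolding vertex_sign_def below_w below_v using assms(1) by simp
qed (simp add: eq_commute)

lemma incidence_remove:
  assumes "v \<in> \<tau>"
  shows "incidence \<tau> (\<tau> - {v}) = vertex_sign \<tau> v"
proof -
  have "\<tau> - (\<tau> - {v}) = {v}"
    using assms by auto
  then show ?thesis
    using assms by (auto simp: incidence_def vertex_sign_def)
qed

lemma abs_incidence_le: "\<bar>incidence \<tau> \<sigma>\<bar> \<le> of_bool (\<sigma> \<subseteq> \<tau>)"
  by (auto simp: incidence_def power_abs)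

lemma finite_face: "abstract_complex V X \<Longrightarrow> \<tau> \<in> ifaces X i \<Longrightarrow> finite \<tau>"
  using finite_subset by (auto simp: abstract_complex_def ifaces_def)

lemma facets_eq_image:
  assumes "abstract_complex V X" "\<tau> \<in> ifaces X (i + 1)"
  shows "{\<sigma> \<in> ifaces X i. \<sigma> \<subseteq> \<tau>} = (\<lambda>v. \<tau> - {v}) ` \<tau>"
proof (intro equalityI subsetI)
  have \<tau>: "\<tau> \<in> X" "int (card \<tau>) = i + 2" "finite \<tau>"
    using assms finite_face[OF assms] by (auto simp: ifaces_def)
  show "\<sigma> \<in> (\<lambda>v. \<tau> - {v}) ` \<tau>" if "\<sigma> \<in> {\<sigma> \<in> ifaces X i. \<sigma> \<subseteq> \<tau>}" for \<sigma>
  proof -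
    have "\<sigma> \<subseteq> \<tau>" "card (\<tau> - \<sigma>) = 1"
      using that \<tau> by (auto simp: ifaces_def card_Diff_subset finite_subset)
    then obtain v where "\<tau> - \<sigma> = {v}"
      by (metis card_1_singletonE)
    then have "v \<in> \<tau>" "\<sigma> = \<tau> - {v}"
      using \<open>\<sigma> \<subseteq> \<tau>\<close> by auto
    then show ?thesis
      by blast
  qed
  show "\<sigma> \<in> {\<sigma> \<in> ifaces X i. \<sigma> \<subseteq> \<tau>}" if facet: "\<sigma> \<in> (\<lambda>v. \<tau> - {v}) ` \<tau>" for \<sigma>
  proof -
    obtain v where v: "v \<in> \<tau>" "\<sigma> = \<tau> - {v}"
      using facet by blast
    then have "card \<tau> = Suc (card \<sigma>)"
      using \<tau>(3) card.remove by metis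
    moreover have "\<sigma> \<in> X"
      using assms(1) \<tau>(1) v(2) by (auto simp: abstract_complex_def)
    ultimately show ?thesis
      using \<tau>(2) v(2) by (auto simp: ifaces_def)
  qed
qed

lemma remove_vertex_mem_ifaces:
  assumes "abstract_complex V X" "\<tau> \<in> ifaces X (i + 1)" "v \<in> \<tau>"
  shows "\<tau> - {v} \<in> ifaces X i"
  using facets_eq_image[OF assms(1,2)] assms(3) by blast

lemma sum_facets:
  assumes "abstract_complex V X" "\<tau> \<in> ifaces X (i + 1)"
  shows "(\<Sum>\<sigma> | \<sigma> \<in> ifaces X i \<and> \<sigma> \<subseteq> \<tau>. g \<sigma>) = (\<Sum>v\<in>\<tau>. g (\<tau> - {v}))"
proof -
  have "inj_on (\<lambda>v. \<tau> - {v}) \<tau>"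
    by (auto simp: inj_on_def)
  then show ?thesis
    by (simp add: facets_eq_image[OF assms] sum.reindex)
qed

lemma coboundary_eq_sum_vertices:
  assumes "abstract_complex V X" "\<tau> \<in> ifaces X (i + 1)"
  shows "coboundary X i f \<tau> = (\<Sum>v\<in>\<tau>. vertex_sign \<tau> v * f (\<tau> - {v}))"
proof -
  have "coboundary X i f \<tau> = (\<Sum>\<sigma>\<in>ifaces X i. incidence \<tau> \<sigma> * f \<sigma>)"
    using assms(2) by (simp add: coboundary_def)
  also have "\<dots> = (\<Sum>\<sigma> | \<sigma> \<in> ifaces X i \<and> \<sigma> \<subseteq> \<tau>. incidence \<tau> \<sigma> * f \<sigma>)"
    using finite_ifaces[OF abstract_complex_finite[OF assms(1)]]
    by (intro sum.mono_neutral_right) (auto simp: incidence_def)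
  also have "\<dots> = (\<Sum>v\<in>\<tau>. vertex_sign \<tau> v * f (\<tau> - {v}))"
    by (simp add: sum_facets[OF assms] incidence_remove)
  finally show ?thesis .
qed

lemma coboundary_coboundary:
  assumes X: "abstract_complex V X"
  shows "coboundary X (i + 1) (coboundary X i f) = (\<lambda>_. 0)"
proof
  fix \<tau>
  show "coboundary X (i + 1) (coboundary X i f) \<tau> = 0"
  proof (cases "\<tau> \<in> ifaces X (i + 1 + 1)")
    case True
    have fin: "finite \<tau>"
      by (rule finite_face[OF X True])
    define P where "P = Sigma \<tau> (\<lambda>v. \<tau> - {v})"
    define t where "t v w = vertex_sign \<tau> v * vertex_sign (\<tau> - {v}) w * f (\<tau> - {v} - {w})" for v w
    have "coboundary X (i + 1) (coboundary X i f) \<tau>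
        = (\<Sum>v\<in>\<tau>. vertex_sign \<tau> v * coboundary X i f (\<tau> - {v}))"
      by (rule coboundary_eq_sum_vertices[OF X True])
    also have "\<dots> = (\<Sum>v\<in>\<tau>. \<Sum>w\<in>\<tau> - {v}. t v w)"
      by (simp add: coboundary_eq_sum_vertices[OF X remove_vertex_mem_ifaces[OF X True]]
          t_def sum_distrib_left mult.assoc)
    also have "\<dots> = (\<Sum>(v, w)\<in>P. t v w)"
      using fin by (simp add: P_def sum.Sigma)
    also have "\<dots> = 0"
    proof -
      have "t w v = - t v w" if "(v, w) \<in> P" for v w
        using that vertex_sign_remove_swap[OF fin, of v w]
        by (auto simp: P_def t_def Diff_insert2[symmetric] insert_commute)
      then have "(\<Sum>(v, w)\<in>P. t w v) = - (\<Sum>(v, w)\<in>P. t v w)"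
        unfolding sum_negf[symmetric] by (intro sum.cong) auto
      moreover have "(\<Sum>(v, w)\<in>P. t w v) = (\<Sum>(v, w)\<in>P. t v w)"
        by (rule sum.reindex_bij_witness[of _ prod.swap prod.swap]) (auto simp: P_def)
      ultimately show ?thesis
        by simp
    qed
    finally show ?thesis .
  qed (simp add: coboundary_def)
qed

lemma coboundary_diff:
  "coboundary X i (\<lambda>\<sigma>. f \<sigma> - g \<sigma>) = (\<lambda>\<tau>. coboundary X i f \<tau> - coboundary X i g \<tau>)"
  by (auto simp: coboundary_def fun_eq_iff sum_subtractf algebra_simps)

lemma cochain_inner_self_eq_0_iff:
  assumes "finite X" "f \<in> cochains X i"
  shows "cochain_inner X i f f = 0 \<longleftrightarrow> f = (\<lambda>_. 0)"
  using assms(2)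
  by (auto simp: cochain_inner_eq_inner_on inner_on_self_eq_0_iff[OF finite_ifaces[OF assms(1)]]
      cochains_def fun_eq_iff)

lemma boundary_boundary:
  assumes X: "abstract_complex V X"
  shows "boundary X i (boundary X (i + 1) g) = (\<lambda>_. 0)" (is "?w = _")
proof -
  have fin: "finite X"
    by (rule abstract_complex_finite[OF X])
  have "cochain_inner X (i - 1) ?w ?w
      = cochain_inner X i (coboundary X (i - 1) ?w) (boundary X (i + 1) g)"
    by (rule boundary_adjoint[OF fin, symmetric])
  also have "\<dots> = cochain_inner X (i + 1) (coboundary X i (coboundary X (i - 1) ?w)) g"
    using boundary_adjoint[OF fin, of "i + 1" _ g] by simp
  also have "\<dots> = 0"
    using coboundary_coboundary[OF X, of "i - 1"] by (simp add: cochain_inner_def)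
  finally show ?thesis
    using cochain_inner_self_eq_0_iff[OF fin boundary_mem[OF fin]] by blast
qed

lemma cochain_inner_up_laplacian:
  assumes "finite X"
  shows "cochain_inner X i f (up_laplacian X i g)
    = cochain_inner X (i + 1) (coboundary X i f) (coboundary X i g)"
  using boundary_adjoint[OF assms, of "i + 1" f "coboundary X i g"] by (simp add: up_laplacian_def)

lemma up_laplacian_mem_cycles:
  assumes "abstract_complex V X"
  shows "up_laplacian X i f \<in> cycles X i"
  using boundary_boundary[OF assms] boundary_mem[OF abstract_complex_finite[OF assms], of "i + 1"]
  by (simp add: cycles_def up_laplacian_def)

lemma mem_cycles_iff:
  assumes "finite X"
  shows "f \<in> cycles X i \<longleftrightarrow> (\<forall>\<sigma>. \<sigma> \<notin> ifaces X i \<longrightarrow> f \<sigma> = 0) \<and>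
    (\<forall>\<rho>. \<rho> \<in> ifaces X (i - 1) \<longrightarrow> (\<Sum>\<sigma>\<in>ifaces X i. incidence \<sigma> \<rho> * f \<sigma>) = 0)"
  by (auto simp: cycles_def cochains_def boundary_eq[OF assms] fun_eq_iff)

lemma closed_cycles:
  assumes "finite X"
  shows "closed (cycles X i)"
proof -
  have "cycles X i = {f. \<forall>\<sigma>. \<sigma> \<notin> ifaces X i \<longrightarrow> f \<sigma> = 0} \<inter>
      {f. \<forall>\<rho>. \<rho> \<in> ifaces X (i - 1) \<longrightarrow> (\<Sum>\<sigma>\<in>ifaces X i. incidence \<sigma> \<rho> * f \<sigma>) = 0}"
    using mem_cycles_iff[OF assms] by blast
  also have "closed \<dots>"
    by (intro closed_Int closed_Collect_all closed_Collect_imp open_Collect_const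
        closed_Collect_eq continuous_intros)
  finally show ?thesis .
qed

lemma cycles_add_scaled:
  assumes "finite X" "f \<in> cycles X i" "g \<in> cycles X i"
  shows "(\<lambda>\<sigma>. f \<sigma> + t * g \<sigma>) \<in> cycles X i"
proof -
  have "(\<Sum>\<sigma>\<in>ifaces X i. incidence \<sigma> \<rho> * (f \<sigma> + t * g \<sigma>))
    = (\<Sum>\<sigma>\<in>ifaces X i. incidence \<sigma> \<rho> * f \<sigma>) + t * (\<Sum>\<sigma>\<in>ifaces X i. incidence \<sigma> \<rho> * g \<sigma>)" for \<rho>
    by (simp add: sum_distrib_left sum.distrib algebra_simps)
  then show ?thesis
    using assms by (simp add: mem_cycles_iff)
qed

lemma continuous_on_up_laplacian:
  assumes "finite X"
  shows "continuous_on A (\<lambda>f. up_laplacian X i f \<sigma>)"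
proof -
  have "continuous_on A (\<lambda>f. coboundary X i f \<tau>)" for \<tau>
    by (cases "\<tau> \<in> ifaces X (i + 1)") (auto simp: coboundary_def intro!: continuous_intros)
  then show ?thesis
    by (cases "\<sigma> \<in> ifaces X i")
      (auto simp: up_laplacian_def boundary_eq[OF assms] intro!: continuous_intros)
qed

lemma self_adjoint_operator_up_laplacian:
  assumes X: "abstract_complex V X"
  shows "self_adjoint_operator (ifaces X i) (cycles X i) (up_laplacian X i)"
proof
  have fin: "finite X"
    by (rule abstract_complex_finite[OF X])
  show "finite (ifaces X i)"
    by (rule finite_ifaces[OF fin])
  show "f \<sigma> = 0" if "f \<in> cycles X i" "\<sigma> \<notin> ifaces X i" for f \<sigma>
    using that by (simp add: cycles_def cochains_def)
  show "(\<lambda>\<sigma>. f \<sigma> + t * g \<sigma>) \<in> cycles X i" if "f \<in> cycles X i" "g \<in> cycles X i" for f g t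
    by (rule cycles_add_scaled[OF fin that])
  show "closed (cycles X i)"
    by (rule closed_cycles[OF fin])
  show "up_laplacian X i f \<in> cycles X i" for f
    by (rule up_laplacian_mem_cycles[OF X])
  show "inner_on (ifaces X i) f (up_laplacian X i g) = inner_on (ifaces X i) (up_laplacian X i f) g"
    for f g
    using cochain_inner_up_laplacian[OF fin, of i f g] cochain_inner_up_laplacian[OF fin, of i g f]
    by (simp add: cochain_inner_eq_inner_on inner_on_commute)
  show "continuous_on (cycles X i) (\<lambda>f. up_laplacian X i f \<sigma>)" for \<sigma>
    by (rule continuous_on_up_laplacian[OF fin])
qed

lemma spectral_gap_le_rayleigh_quotient:
  assumes X: "abstract_complex V X" and f: "f \<in> cycles X (int k - 1)"
  shows "spectral_gap X k * cochain_inner X (int k - 1) f f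
    \<le> cochain_inner X (int k) (coboundary X (int k - 1) f) (coboundary X (int k - 1) f)"
proof -
  have fin: "finite X"
    by (rule abstract_complex_finite[OF X])
  interpret self_adjoint_operator "ifaces X (int k - 1)" "cycles X (int k - 1)"
    "up_laplacian X (int k - 1)"
    by (rule self_adjoint_operator_up_laplacian[OF X])
  show ?thesis
    using least_eigenvalue_le_rayleigh_quotient[OF f]
      cochain_inner_up_laplacian[OF fin, of "int k - 1" f f]
    by (simp add: spectral_gap_def coboundaries_perp_eq_cycles[OF fin] cochain_inner_eq_inner_on)
qed

lemma cycle_modulo_coboundary_exists:
  assumes X: "finite X" and u: "u \<in> cochains X i"
  obtains h where "(\<lambda>\<sigma>. u \<sigma> - coboundary X (i - 1) h \<sigma>) \<in> cycles X i"
proof -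
  obtain h where h: "\<forall>\<rho>\<in>ifaces X (i - 1). inner_on (ifaces X i)
      (\<lambda>\<sigma>. u \<sigma> - (\<Sum>\<rho>\<in>ifaces X (i - 1). h \<rho> * incidence \<sigma> \<rho>)) (\<lambda>\<sigma>. incidence \<sigma> \<rho>) = 0"
    using orthogonal_residual_exists[OF finite_ifaces[OF X],
        of "i - 1" "ifaces X i" u "\<lambda>\<rho> \<sigma>. incidence \<sigma> \<rho>"] by blast
  have "(\<Sum>\<sigma>\<in>ifaces X i. incidence \<sigma> \<rho> * (u \<sigma> - coboundary X (i - 1) h \<sigma>)) = 0"
    if "\<rho> \<in> ifaces X (i - 1)" for \<rho>
    using h that by (simp add: inner_on_def coboundary_def mult.commute)
  then show thesis
    using that[of h] u by (simp add: mem_cycles_iff[OF X] cochains_def coboundary_def)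
qed

lemma cochain_inner_coboundary_cycle:
  assumes "finite X" "f \<in> cycles X i"
  shows "cochain_inner X i (coboundary X (i - 1) h) f = 0"
  using assms(2) unfolding boundary_adjoint[OF assms(1)] by (simp add: cycles_def cochain_inner_def)

lemma spectral_gap_mult_inner_square_le:
  assumes X: "abstract_complex V X"
    and u: "u \<in> cochains X (int k - 1)" and f: "f \<in> cycles X (int k - 1)"
  shows "spectral_gap X k * (cochain_inner X (int k - 1) u f)\<^sup>2
    \<le> cochain_inner X (int k) (coboundary X (int k - 1) u) (coboundary X (int k - 1) u)
      * cochain_inner X (int k - 1) f f" (is "_ \<le> ?energy u * ?norm f")
proof (cases "0 \<le> spectral_gap X k")
  case True
  let ?i = "int k - 1"
  have fin: "finite X"
    by (rule abstract_complex_finite[OF X])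
  obtain h where h: "(\<lambda>\<sigma>. u \<sigma> - coboundary X (?i - 1) h \<sigma>) \<in> cycles X ?i"
    using cycle_modulo_coboundary_exists[OF fin u] .
  define z where "z = (\<lambda>\<sigma>. u \<sigma> - coboundary X (?i - 1) h \<sigma>)"
  have inner_z: "cochain_inner X ?i z f = cochain_inner X ?i u f"
    using cochain_inner_coboundary_cycle[OF fin f]
    by (simp add: z_def cochain_inner_eq_inner_on inner_on_linear_left)
  have coboundary_z: "coboundary X ?i z = coboundary X ?i u"
    using coboundary_coboundary[OF X, of "?i - 1" h] by (simp add: z_def coboundary_diff)
  have "spectral_gap X k * (cochain_inner X ?i u f)\<^sup>2 \<le> spectral_gap X k * (?norm z * ?norm f)"
    unfolding inner_z[symmetric] unfolding cochain_inner_eq_inner_on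
    by (rule mult_left_mono[OF inner_on_Cauchy_Schwarz True])
  also have "\<dots> \<le> ?energy z * ?norm f"
    using mult_right_mono[OF spectral_gap_le_rayleigh_quotient[OF X h], of "?norm f"]
    by (simp add: z_def mult.assoc cochain_inner_eq_inner_on inner_on_self_nonneg)
  finally show ?thesis
    unfolding coboundary_z .
next
  case False
  then have "spectral_gap X k * (cochain_inner X (int k - 1) u f)\<^sup>2 \<le> 0"
    by (simp add: mult_nonpos_nonneg)
  also have "0 \<le> ?energy u * ?norm f"
    by (simp add: cochain_inner_eq_inner_on inner_on_self_nonneg)
  finally show ?thesis .
qed

section \<open>The cochain of a vertex colouring\<close>

definition colour_sign :: "('a::linorder \<Rightarrow> nat) \<Rightarrow> 'a set \<Rightarrow> real" where
  "colour_sign c \<sigma> = (\<Prod>x\<in>\<sigma>. \<Prod>y\<in>\<sigma>. if y < x \<and> c x < c y then - 1 else 1)"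

lemma abs_colour_sign: "\<bar>colour_sign c \<sigma>\<bar> = 1"
  unfolding colour_sign_def abs_prod by (intro prod.neutral ballI) simp

lemma minus_one_power_card_filter:
  assumes "finite S"
  shows "(- 1) ^ card {x \<in> S. P x} = (\<Prod>x\<in>S. if P x then - 1 else (1 :: real))"
  using assms by (simp add: prod.If_cases Int_def)

text \<open>Moving \<open>v\<close> to the front of \<open>\<sigma>\<close> in both the vertex order and the colour order.\<close>

lemma colour_sign_remove:
  fixes \<sigma> :: "'a::linorder set"
  assumes "finite \<sigma>" "v \<in> \<sigma>" and distinct: "\<And>w. w \<in> \<sigma> - {v} \<Longrightarrow> c w \<noteq> c v"
  shows "colour_sign c \<sigma>
    = vertex_sign \<sigma> v * (- 1) ^ card {w \<in> \<sigma> - {v}. c w < c v} * colour_sign c (\<sigma> - {v})"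
proof -
  define \<rho> where "\<rho> = \<sigma> - {v}"
  have \<rho>: "finite \<rho>" "v \<notin> \<rho>" "\<sigma> = insert v \<rho>"
    using assms(1,2) by (auto simp: \<rho>_def)
  define inversion_sign :: "'a \<Rightarrow> 'a \<Rightarrow> real"
    where "inversion_sign x y = (if y < x \<and> c x < c y then - 1 else 1)" for x y
  have "colour_sign c \<sigma> = (\<Prod>w\<in>\<rho>. inversion_sign v w * inversion_sign w v) * colour_sign c \<rho>"
    using \<rho>(1,2) by (simp add: \<rho>(3) colour_sign_def inversion_sign_def prod.distrib)
  also have "(\<Prod>w\<in>\<rho>. inversion_sign v w * inversion_sign w v)
      = (\<Prod>w\<in>\<rho>. (if w < v then - 1 else 1) * (if c w < c v then - 1 else 1))"
  proof (rule prod.cong[OF refl])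
    fix w assume "w \<in> \<rho>"
    then have "w \<noteq> v" "c w \<noteq> c v"
      using distinct by (auto simp: \<rho>_def)
    then show "inversion_sign v w * inversion_sign w v
        = (if w < v then - 1 else 1) * (if c w < c v then - 1 else 1)"
      by (auto simp: inversion_sign_def)
  qed
  also have "\<dots> = vertex_sign \<rho> v * (- 1) ^ card {w \<in> \<rho>. c w < c v}"
    by (simp add: vertex_sign_def minus_one_power_card_filter[OF \<rho>(1)] prod.distrib)
  finally show ?thesis
    by (simp add: \<rho>_def vertex_sign_remove_self)
qed

lemma colour_sign_same_colour_cancel:
  assumes "finite \<tau>" "u \<in> \<tau>" "v \<in> \<tau>" "u \<noteq> v" "c u = c v"
    and distinct: "\<And>w. w \<in> \<tau> - {u, v} \<Longrightarrow> c w \<noteq> c u"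
  shows "vertex_sign \<tau> u * colour_sign c (\<tau> - {u}) + vertex_sign \<tau> v * colour_sign c (\<tau> - {v}) = 0"
proof -
  define K where "K = (- 1) ^ card {w \<in> \<tau> - {u, v}. c w < c u} * colour_sign c (\<tau> - {u, v})"
  have "\<tau> - {u} - {v} = \<tau> - {u, v}" "\<tau> - {v} - {u} = \<tau> - {u, v}"
    by auto
  then have "colour_sign c (\<tau> - {u}) = vertex_sign (\<tau> - {u}) v * K"
    and "colour_sign c (\<tau> - {v}) = vertex_sign (\<tau> - {v}) u * K"
    using assms colour_sign_remove[of "\<tau> - {u}" v c] colour_sign_remove[of "\<tau> - {v}" u c]
    by (simp_all add: K_def mult.assoc)
  then have "vertex_sign \<tau> u * colour_sign c (\<tau> - {u}) + vertex_sign \<tau> v * colour_sign c (\<tau> - {v})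
      = (vertex_sign \<tau> u * vertex_sign (\<tau> - {u}) v + vertex_sign \<tau> v * vertex_sign (\<tau> - {v}) u) * K"
    by (simp add: algebra_simps)
  also have "\<dots> = 0"
    using vertex_sign_remove_swap[OF assms(1-4)] by simp
  finally show ?thesis .
qed

definition colourful_faces :: "'a set set \<Rightarrow> nat \<Rightarrow> ('a \<Rightarrow> nat) \<Rightarrow> 'a set set" where
  "colourful_faces X k c = {\<tau> \<in> ifaces X (int k). c ` \<tau> = {..k}}"

definition colour_cochain :: "'a::linorder set set \<Rightarrow> nat \<Rightarrow> ('a \<Rightarrow> nat) \<Rightarrow> 'a set \<Rightarrow> real" where
  "colour_cochain X k c \<sigma> =
     (if \<sigma> \<in> ifaces X (int k - 1) \<and> c ` \<sigma> = {1..k} then colour_sign c \<sigma> else 0)"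

lemma colour_cochain_mem_cochains: "colour_cochain X k c \<in> cochains X (int k - 1)"
  by (simp add: cochains_def colour_cochain_def)

lemma image_remove_if_eq:
  assumes "x \<in> S" "y \<in> S" "x \<noteq> y" "f x = f y"
  shows "f ` (S - {x}) = f ` S"
proof -
  have "f x \<in> f ` (S - {x})"
    using assms by (intro image_eqI[of _ _ y]) auto
  then show ?thesis
    using image_insert[of f x "S - {x}"] assms(1) by (simp add: insert_absorb)
qed

lemma coboundary_colour_cochain_eq_sum:
  assumes X: "abstract_complex V X" and \<tau>: "\<tau> \<in> ifaces X (int k)"
  shows "coboundary X (int k - 1) (colour_cochain X k c) \<tau>
    = (\<Sum>v | v \<in> \<tau> \<and> c ` (\<tau> - {v}) = {1..k}. vertex_sign \<tau> v * colour_sign c (\<tau> - {v}))"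
proof -
  have \<tau>': "\<tau> \<in> ifaces X (int k - 1 + 1)"
    using \<tau> by simp
  show ?thesis
    unfolding coboundary_eq_sum_vertices[OF X \<tau>']
    using remove_vertex_mem_ifaces[OF X \<tau>'] finite_face[OF X \<tau>]
    by (intro sum.mono_neutral_cong_right) (auto simp: colour_cochain_def)
qed

lemma abs_coboundary_colour_cochain_colourful:
  assumes X: "abstract_complex V X" and "\<tau> \<in> colourful_faces X k c"
  shows "\<bar>coboundary X (int k - 1) (colour_cochain X k c) \<tau>\<bar> = 1"
proof -
  have \<tau>: "\<tau> \<in> ifaces X (int k)" and image: "c ` \<tau> = {..k}"
    using assms(2) by (auto simp: colourful_faces_def)
  have "card \<tau> = k + 1" "finite \<tau>"
    using \<tau> finite_face[OF X \<tau>] by (auto simp: ifaces_def)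
  then have inj: "inj_on c \<tau>"
    using image by (intro eq_card_imp_inj_on) auto
  obtain v where v: "v \<in> \<tau>" "c v = 0"
    using image by (metis atMost_iff imageE zero_le)
  have "c ` (\<tau> - {w}) = {1..k} \<longleftrightarrow> w = v" if "w \<in> \<tau>" for w
  proof -
    have "c ` (\<tau> - {w}) = {..k} - {c w}"
      using inj_on_image_set_diff[OF inj, of \<tau> "{w}"] that image by auto
    moreover have "{1..k} = {..k} - {0}"
      by auto
    then have "{..k} - {c w} = {1..k} \<longleftrightarrow> c w = 0"
      by (metis Diff_iff atMost_iff singletonD singletonI zero_le)
    moreover have "c w = 0 \<longleftrightarrow> w = v"
      using inj_onD[OF inj] v that by metis
    ultimately show ?thesis
      by simp
  qed
  then have "{w \<in> \<tau>. c ` (\<tau> - {w}) = {1..k}} = {v}"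
    using v by blast
  then show ?thesis
    by (simp add: coboundary_colour_cochain_eq_sum[OF X \<tau>] abs_mult abs_vertex_sign abs_colour_sign)
qed

lemma coboundary_colour_cochain_not_colourful:
  assumes X: "abstract_complex V X" and colours: "c ` V \<subseteq> {..k}"
    and \<tau>: "\<tau> \<in> ifaces X (int k)" and "\<tau> \<notin> colourful_faces X k c"
  shows "coboundary X (int k - 1) (colour_cochain X k c) \<tau> = 0"
proof -
  have card: "card \<tau> = k + 1" and fin: "finite \<tau>"
    using \<tau> finite_face[OF X \<tau>] by (auto simp: ifaces_def)
  have "c ` \<tau> \<subseteq> {..k}"
    using X \<tau> colours by (auto simp: abstract_complex_def ifaces_def)
  moreover have "c ` \<tau> \<noteq> {..k}"
    using assms(3,4) by (simp add: colourful_faces_def)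
  ultimately have "\<not> inj_on c \<tau>"
    using card card_image[of c \<tau>] card_subset_eq[of "{..k}" "c ` \<tau>"] by auto
  then obtain u v where uv: "u \<in> \<tau>" "v \<in> \<tau>" "u \<noteq> v" "c u = c v"
    by (auto simp: inj_on_def)
  have image: "c ` (\<tau> - {u}) = c ` \<tau>" "c ` (\<tau> - {v}) = c ` \<tau>"
    using uv image_remove_if_eq by metis+
  have inj: "inj_on c (\<tau> - {w})" if "w \<in> \<tau>" "c ` (\<tau> - {w}) = {1..k}" for w
    using that card fin by (intro eq_card_imp_inj_on) auto
  have only_uv: "w = u \<or> w = v" if "w \<in> \<tau>" "c ` (\<tau> - {w}) = {1..k}" for w
    using inj_onD[OF inj[OF that], of u v] uv by auto
  show ?thesis
  proof (cases "c ` \<tau> = {1..k}")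
    case True
    then have "{w \<in> \<tau>. c ` (\<tau> - {w}) = {1..k}} = {u, v}"
      using only_uv uv image by auto
    moreover have "c w \<noteq> c u" if "w \<in> \<tau> - {u, v}" for w
      using inj_onD[OF inj[OF uv(1)], of w v] that uv image True by auto
    ultimately show ?thesis
      using colour_sign_same_colour_cancel[OF fin uv] uv(3)
      by (simp add: coboundary_colour_cochain_eq_sum[OF X \<tau>])
  next
    case False
    then have "{w \<in> \<tau>. c ` (\<tau> - {w}) = {1..k}} = {}"
      using only_uv image by (metis (mono_tags, lifting) empty_Collect_eq)
    then show ?thesis
      by (simp only: coboundary_colour_cochain_eq_sum[OF X \<tau>] sum.empty)
  qed
qed

lemma abs_coboundary_colour_cochain:
  assumes "abstract_complex V X" "c ` V \<subseteq> {..k}" "\<tau> \<in> ifaces X (int k)"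
  shows "\<bar>coboundary X (int k - 1) (colour_cochain X k c) \<tau>\<bar>
    = of_bool (\<tau> \<in> colourful_faces X k c)"
  using assms abs_coboundary_colour_cochain_colourful coboundary_colour_cochain_not_colourful
  by (cases "\<tau> \<in> colourful_faces X k c") auto

lemma cochain_inner_coboundary_colour_cochain:
  assumes X: "abstract_complex V X" and c: "c ` V \<subseteq> {..k}"
  shows "cochain_inner X (int k) (coboundary X (int k - 1) (colour_cochain X k c))
    (coboundary X (int k - 1) (colour_cochain X k c)) = card (colourful_faces X k c)"
    (is "cochain_inner _ _ ?g ?g = _")
proof -
  have "?g \<tau> * ?g \<tau> = of_bool (\<tau> \<in> colourful_faces X k c)" if "\<tau> \<in> ifaces X (int k)" for \<tau>
    using abs_coboundary_colour_cochain[OF X c that] by (subst abs_mult_self_eq[symmetric]) simp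
  then have "cochain_inner X (int k) ?g ?g
      = (\<Sum>\<tau>\<in>ifaces X (int k). of_bool (\<tau> \<in> colourful_faces X k c))"
    by (simp add: cochain_inner_def)
  also have "\<dots> = card (colourful_faces X k c)"
    using finite_ifaces[OF abstract_complex_finite[OF X]]
    by (simp add: colourful_faces_def Int_def)
  finally show ?thesis .
qed

definition degree_in :: "'a set set \<Rightarrow> 'a set \<Rightarrow> nat" where
  "degree_in R \<sigma> = card {\<tau> \<in> R. \<sigma> \<subseteq> \<tau>}"

lemma abs_up_laplacian_colour_cochain_le:
  assumes X: "abstract_complex V X" and c: "c ` V \<subseteq> {..k}"
  shows "\<bar>up_laplacian X (int k - 1) (colour_cochain X k c) \<sigma>\<bar>
    \<le> degree_in (colourful_faces X k c) \<sigma>"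
proof (cases "\<sigma> \<in> ifaces X (int k - 1)")
  case True
  let ?g = "coboundary X (int k - 1) (colour_cochain X k c)"
  have fin: "finite X"
    by (rule abstract_complex_finite[OF X])
  have "\<bar>up_laplacian X (int k - 1) (colour_cochain X k c) \<sigma>\<bar>
      \<le> (\<Sum>\<tau>\<in>ifaces X (int k). \<bar>incidence \<tau> \<sigma> * ?g \<tau>\<bar>)"
    using True by (simp add: up_laplacian_def boundary_eq[OF fin])
  also have "\<dots> \<le> (\<Sum>\<tau>\<in>ifaces X (int k). of_bool (\<tau> \<in> colourful_faces X k c \<and> \<sigma> \<subseteq> \<tau>))"
  proof (rule sum_mono)
    fix \<tau> assume "\<tau> \<in> ifaces X (int k)"
    then show "\<bar>incidence \<tau> \<sigma> * ?g \<tau>\<bar> \<le> of_bool (\<tau> \<in> colourful_faces X k c \<and> \<sigma> \<subseteq> \<tau>)"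
      using abs_incidence_le[of \<tau> \<sigma>] abs_coboundary_colour_cochain[OF X c]
      by (auto simp: abs_mult of_bool_def split: if_splits)
  qed
  also have "\<dots> = degree_in (colourful_faces X k c) \<sigma>"
    using finite_ifaces[OF fin] by (simp add: degree_in_def colourful_faces_def Int_def conj_assoc)
  finally show ?thesis .
qed (simp add: up_laplacian_def boundary_eq[OF abstract_complex_finite[OF X]])

lemma sum_square_degree_in:
  assumes X: "abstract_complex V X" and R: "R \<subseteq> ifaces X (i + 1)"
  shows "(\<Sum>\<sigma>\<in>ifaces X i. (degree_in R \<sigma>)\<^sup>2)
    = (\<Sum>\<tau>\<in>R. \<Sum>v\<in>\<tau>. degree_in R (\<tau> - {v}))"
proof -
  let ?d = "degree_in R"
  have fin: "finite (ifaces X i)" "finite R"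
    using finite_ifaces[OF abstract_complex_finite[OF X]] finite_subset[OF R] by auto
  have "(\<Sum>\<sigma>\<in>ifaces X i. (?d \<sigma>)\<^sup>2) = (\<Sum>\<sigma>\<in>ifaces X i. \<Sum>\<tau> | \<tau> \<in> R \<and> \<sigma> \<subseteq> \<tau>. ?d \<sigma>)"
    by (simp add: degree_in_def power2_eq_square)
  also have "\<dots> = (\<Sum>\<tau>\<in>R. \<Sum>\<sigma> | \<sigma> \<in> ifaces X i \<and> \<sigma> \<subseteq> \<tau>. ?d \<sigma>)"
    by (rule sum.swap_restrict[OF fin])
  also have "\<dots> = (\<Sum>\<tau>\<in>R. \<Sum>v\<in>\<tau>. ?d (\<tau> - {v}))"
    using R by (intro sum.cong refl sum_facets[OF X]) auto
  finally show ?thesis .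
qed

lemma cochain_inner_up_laplacian_colour_cochain_le:
  assumes X: "abstract_complex V X" and c: "c ` V \<subseteq> {..k}"
    and D: "\<And>\<tau>. \<tau> \<in> colourful_faces X k c \<Longrightarrow>
      (\<Sum>v\<in>\<tau>. degree_in (colourful_faces X k c) (\<tau> - {v})) \<le> D"
  shows "cochain_inner X (int k - 1) (up_laplacian X (int k - 1) (colour_cochain X k c))
    (up_laplacian X (int k - 1) (colour_cochain X k c)) \<le> D * card (colourful_faces X k c)"
    (is "cochain_inner _ _ ?f ?f \<le> _")
proof -
  let ?R = "colourful_faces X k c"
  have "cochain_inner X (int k - 1) ?f ?f = (\<Sum>\<sigma>\<in>ifaces X (int k - 1). \<bar>?f \<sigma>\<bar>\<^sup>2)"
    by (simp add: cochain_inner_def power2_eq_square)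
  also have "\<dots> \<le> (\<Sum>\<sigma>\<in>ifaces X (int k - 1). (real (degree_in ?R \<sigma>))\<^sup>2)"
    by (intro sum_mono power_mono abs_up_laplacian_colour_cochain_le[OF X c]) simp
  also have "\<dots> = real (\<Sum>\<sigma>\<in>ifaces X (int k - 1). (degree_in ?R \<sigma>)\<^sup>2)"
    by simp
  also have "\<dots> = real (\<Sum>\<tau>\<in>?R. \<Sum>v\<in>\<tau>. degree_in ?R (\<tau> - {v}))"
    by (subst sum_square_degree_in[OF X]) (auto simp: colourful_faces_def)
  also have "\<dots> \<le> real (\<Sum>\<tau>\<in>?R. D)"
    unfolding of_nat_le_iff by (rule sum_mono[OF D])
  finally show ?thesis
    by (simp add: mult.commute)
qed

lemma cycles_cong:
  assumes "finite X" "finite Y" "ifaces X i = ifaces Y i" "ifaces X (i - 1) = ifaces Y (i - 1)"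
  shows "cycles X i = cycles Y i"
  using assms by (auto simp: mem_cycles_iff)

lemma spectral_gap_mult_card_colourful_faces_le:
  fixes V :: "'a::linorder set"
  assumes X: "abstract_complex V X" and Y: "abstract_complex V Y"
    and skeleton: "\<And>i. i < int k \<Longrightarrow> ifaces Y i = ifaces X i"
    and c: "c ` V \<subseteq> {..k}"
    and D: "\<And>\<tau>. \<tau> \<in> colourful_faces Y k c \<Longrightarrow>
      (\<Sum>v\<in>\<tau>. degree_in (colourful_faces Y k c) (\<tau> - {v})) \<le> D"
  shows "spectral_gap X k * card (colourful_faces Y k c) \<le> D * card (colourful_faces X k c)"
proof (cases "card (colourful_faces Y k c) = 0")
  case False
  let ?i = "int k - 1" and ?m = "real (card (colourful_faces Y k c))"
    and ?n = "real (card (colourful_faces X k c))"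
  define u where "u = colour_cochain X k c"
  define f where "f = up_laplacian Y ?i u"
  have u_eq: "u = colour_cochain Y k c"
    by (simp add: u_def fun_eq_iff colour_cochain_def skeleton)
  have finX: "finite X" and finY: "finite Y"
    using X Y abstract_complex_finite by auto
  have "f \<in> cycles Y ?i"
    unfolding f_def by (rule up_laplacian_mem_cycles[OF Y])
  then have f: "f \<in> cycles X ?i"
    using cycles_cong[OF finX finY, of ?i] by (simp add: skeleton)
  have inner_eq: "cochain_inner X ?i = cochain_inner Y ?i"
    by (simp add: cochain_inner_eq_inner_on skeleton)
  have "spectral_gap X k * (cochain_inner X ?i u f)\<^sup>2
      \<le> cochain_inner X (int k) (coboundary X ?i u) (coboundary X ?i u) * cochain_inner X ?i f f"
    by (rule spectral_gap_mult_inner_square_le[OF X _ f])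
      (simp add: u_def colour_cochain_mem_cochains)
  also have "cochain_inner X (int k) (coboundary X ?i u) (coboundary X ?i u) = ?n"
    unfolding u_def by (rule cochain_inner_coboundary_colour_cochain[OF X c])
  also have "cochain_inner X ?i u f = ?m"
    using cochain_inner_up_laplacian[OF finY, of ?i u u]
      cochain_inner_coboundary_colour_cochain[OF Y c] by (simp add: f_def inner_eq u_eq)
  also have "?n * cochain_inner X ?i f f \<le> ?n * (D * ?m)"
    using cochain_inner_up_laplacian_colour_cochain_le[OF Y c D]
    by (intro mult_left_mono) (simp_all add: f_def inner_eq u_eq)
  finally show ?thesis
    using False by (simp add: power2_eq_square mult_ac)
qed simp

section \<open>Rainbow faces of the completion\<close>

lemma completion_facet_mem:
  assumes "abstract_complex V X" "\<tau> \<in> k_completion V X k" "v \<in> \<tau>"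
  shows "\<tau> - {v} \<in> X"
  using assms by (auto simp: abstract_complex_def k_completion_def)

lemma abstract_complex_completion:
  assumes X: "abstract_complex V X"
  shows "abstract_complex V (k_completion V X k)"
  unfolding abstract_complex_def
proof (intro conjI ballI allI impI)
  show "finite V"
    using X by (simp add: abstract_complex_def)
next
  fix \<tau> assume \<tau>: "\<tau> \<in> k_completion V X k"
  then show "\<tau> \<subseteq> V"
    using X by (auto simp: abstract_complex_def k_completion_def)
  fix \<sigma> assume "\<sigma> \<subseteq> \<tau>"
  show "\<sigma> \<in> k_completion V X k"
  proof (cases "\<sigma> = \<tau>")
    case False
    then obtain v where "v \<in> \<tau>" "\<sigma> \<subseteq> \<tau> - {v}"
      using \<open>\<sigma> \<subseteq> \<tau>\<close> by blast
    moreover have "\<tau> - {v} \<in> X"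
      by (rule completion_facet_mem[OF X \<tau> \<open>v \<in> \<tau>\<close>])
    ultimately have "\<sigma> \<in> X"
      using X by (simp add: abstract_complex_def)
    then show ?thesis
      by (simp add: k_completion_def)
  qed (use \<tau> in simp)
qed

lemma ifaces_completion: "i < int k \<Longrightarrow> ifaces (k_completion V X k) i = ifaces X i"
  by (auto simp: ifaces_def k_completion_def)

lemma rainbow_completion_faces_eq:
  "rainbow_completion_faces V X k A = rainbow_faces (k_completion V X k) k A"
  by (auto simp: rainbow_completion_faces_def rainbow_faces_def ifaces_def)

lemma finite_rainbow_completion_faces:
  assumes "abstract_complex V X"
  shows "finite (rainbow_completion_faces V X k A)"
  using finite_ifaces[OF abstract_complex_finite[OF abstract_complex_completion[OF assms]]]
  by (simp add: rainbow_completion_faces_eq rainbow_faces_def)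

definition part_index :: "(nat \<Rightarrow> 'a set) \<Rightarrow> 'a \<Rightarrow> nat" where
  "part_index A v = (LEAST i. v \<in> A i)"

lemma part_index_le:
  assumes "nonempty_partition V k A" "v \<in> V"
  shows "part_index A v \<le> k"
proof -
  obtain i where "i \<le> k" "v \<in> A i"
    using assms by (auto simp: nonempty_partition_def)
  then show ?thesis
    unfolding part_index_def by (meson Least_le order_trans)
qed

lemma part_index_eq_iff:
  assumes A: "nonempty_partition V k A" and "v \<in> V" "i \<le> k"
  shows "part_index A v = i \<longleftrightarrow> v \<in> A i"
proof
  have "\<exists>j. v \<in> A j"
    using assms by (auto simp: nonempty_partition_def)
  then have mem: "v \<in> A (part_index A v)"
    unfolding part_index_def by (rule LeastI_ex)
  then show "part_index A v = i \<Longrightarrow> v \<in> A i"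
    by simp
  have "disjoint_family_on A {..k}"
    using A by (simp add: nonempty_partition_def)
  then show "v \<in> A i \<Longrightarrow> part_index A v = i"
    using mem part_index_le[OF A \<open>v \<in> V\<close>] \<open>i \<le> k\<close> by (auto simp: disjoint_family_on_def)
qed

lemma rainbow_iff_image_part_index:
  assumes A: "nonempty_partition V k A" and "\<tau> \<subseteq> V" "card \<tau> = k + 1"
  shows "(\<forall>i\<le>k. card (\<tau> \<inter> A i) = 1) \<longleftrightarrow> part_index A ` \<tau> = {..k}"
proof
  have part: "\<tau> \<inter> A i = {v \<in> \<tau>. part_index A v = i}" if "i \<le> k" for i
    using part_index_eq_iff[OF A _ that] \<open>\<tau> \<subseteq> V\<close> by blast
  show "part_index A ` \<tau> = {..k}" if rainbow: "\<forall>i\<le>k. card (\<tau> \<inter> A i) = 1"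
  proof -
    have "i \<in> part_index A ` \<tau>" if "i \<le> k" for i
    proof -
      have "\<tau> \<inter> A i \<noteq> {}"
        using rainbow that by force
      then show ?thesis
        unfolding part[OF that] by blast
    qed
    moreover have "part_index A ` \<tau> \<subseteq> {..k}"
      using part_index_le[OF A] \<open>\<tau> \<subseteq> V\<close> by auto
    ultimately show ?thesis
      by auto
  qed
  show "\<forall>i\<le>k. card (\<tau> \<inter> A i) = 1" if image: "part_index A ` \<tau> = {..k}"
  proof (intro allI impI)
    fix i assume "i \<le> k"
    then obtain v where v: "v \<in> \<tau>" "part_index A v = i"
      using image by (metis atMost_iff imageE)
    have "finite \<tau>"
      using \<open>card \<tau> = k + 1\<close> by (intro card_ge_0_finite) simp
    then have "inj_on (part_index A) \<tau>"
      using image \<open>card \<tau> = k + 1\<close> by (intro eq_card_imp_inj_on) auto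
    then have "{w \<in> \<tau>. part_index A w = i} = {v}"
      using v by (auto simp: inj_on_def)
    then show "card (\<tau> \<inter> A i) = 1"
      by (simp add: part[OF \<open>i \<le> k\<close>])
  qed
qed

lemma rainbow_faces_eq_colourful_faces:
  assumes "abstract_complex V X" "nonempty_partition V k A"
  shows "rainbow_faces X k A = colourful_faces X k (part_index A)"
proof -
  have "(\<forall>i\<le>k. card (\<tau> \<inter> A i) = 1) \<longleftrightarrow> part_index A ` \<tau> = {..k}" if "\<tau> \<in> ifaces X (int k)" for \<tau>
    using that assms(1)
    by (intro rainbow_iff_image_part_index[OF assms(2)])
      (auto simp: ifaces_def abstract_complex_def)
  then show ?thesis
    by (auto simp: rainbow_faces_def colourful_faces_def)
qed

lemma sum_rainbow_degree_le_max:
  assumes "abstract_complex V X" "\<tau> \<in> rainbow_completion_faces V X k A"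
  shows "(\<Sum>v\<in>\<tau>. rainbow_degree V X k A (\<tau> - {v})) \<le> max_degree_sum V X k A"
  unfolding max_degree_sum_def using finite_rainbow_completion_faces[OF assms(1)] assms(2)
  by (intro Max_ge) auto

lemma spectral_gap_mult_card_rainbow_completion_faces_le:
  fixes V :: "'a::linorder set"
  assumes X: "abstract_complex V X" and A: "nonempty_partition V k A"
  shows "spectral_gap X k * card (rainbow_completion_faces V X k A)
    \<le> max_degree_sum V X k A * card (rainbow_faces X k A)"
proof -
  let ?K = "k_completion V X k" and ?c = "part_index A"
  have K: "abstract_complex V ?K"
    by (rule abstract_complex_completion[OF X])
  have completion: "rainbow_completion_faces V X k A = colourful_faces ?K k ?c"
    unfolding rainbow_completion_faces_eq by (rule rainbow_faces_eq_colourful_faces[OF K A])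
  show ?thesis
    unfolding completion rainbow_faces_eq_colourful_faces[OF X A]
  proof (rule spectral_gap_mult_card_colourful_faces_le[OF X K ifaces_completion])
    show "?c ` V \<subseteq> {..k}"
      using part_index_le[OF A] by auto
    show "(\<Sum>v\<in>\<tau>. degree_in (colourful_faces ?K k ?c) (\<tau> - {v})) \<le> max_degree_sum V X k A"
      if "\<tau> \<in> colourful_faces ?K k ?c" for \<tau>
      using sum_rainbow_degree_le_max[OF X, of \<tau> k A] that
      by (simp add: rainbow_degree_def degree_in_def completion)
  qed
qed

lemma max_degree_sum_le:
  assumes X: "abstract_complex V X" and "rainbow_completion_faces V X k A \<noteq> {}"
    and C: "\<forall>\<sigma>\<in>ifaces X (int k - 1).
      real (card {\<tau> \<in> ifaces (k_completion V X k) (int k). \<sigma> \<subseteq> \<tau>}) \<le> C"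
  shows "real (max_degree_sum V X k A) \<le> (real k + 1) * C"
proof -
  let ?K = "k_completion V X k" and ?d = "rainbow_degree V X k A"
  have K: "abstract_complex V ?K"
    by (rule abstract_complex_completion[OF X])
  have "max_degree_sum V X k A
      \<in> (\<lambda>\<tau>. \<Sum>v\<in>\<tau>. ?d (\<tau> - {v})) ` rainbow_completion_faces V X k A"
    unfolding max_degree_sum_def
    using finite_rainbow_completion_faces[OF X] assms(2) by (intro Max_in) auto
  then obtain \<tau> where \<tau>: "\<tau> \<in> rainbow_completion_faces V X k A"
    and max: "max_degree_sum V X k A = (\<Sum>v\<in>\<tau>. ?d (\<tau> - {v}))"
    by blast
  have face: "\<tau> \<in> ifaces ?K (int k)"
    using \<tau> by (simp add: rainbow_completion_faces_eq rainbow_faces_def)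
  have "real (?d (\<tau> - {v})) \<le> C" if "v \<in> \<tau>" for v
  proof -
    have "?d (\<tau> - {v}) \<le> card {\<tau>' \<in> ifaces ?K (int k). \<tau> - {v} \<subseteq> \<tau>'}"
      unfolding rainbow_degree_def rainbow_completion_faces_eq rainbow_faces_def
      using finite_ifaces[OF abstract_complex_finite[OF K]] by (intro card_mono) auto
    moreover have "\<tau> - {v} \<in> ifaces X (int k - 1)"
      using remove_vertex_mem_ifaces[OF K, of \<tau> "int k - 1" v] face that
      by (simp add: ifaces_completion)
    ultimately show ?thesis
      using C by fastforce
  qed
  then have "real (max_degree_sum V X k A) \<le> real (card \<tau>) * C"
    unfolding max of_nat_sum by (rule sum_bounded_above)
  moreover have "card \<tau> = k + 1"
    using \<tau> by (simp add: rainbow_completion_faces_def)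
  ultimately show ?thesis
    by (simp add: algebra_simps)
qed

section \<open>The Cheeger constant\<close>

lemma cheeger_quotient_eq_infinity_iff:
  assumes "abstract_complex V X"
  shows "cheeger_quotient V X k A = \<infinity> \<longleftrightarrow> rainbow_completion_faces V X k A = {}"
  using finite_rainbow_completion_faces[OF assms] by (simp add: cheeger_quotient_def)

lemma spectral_gap_le_cheeger_quotient:
  fixes V :: "'a::linorder set"
  assumes X: "abstract_complex V X" and A: "nonempty_partition V k A"
    and "cheeger_quotient V X k A \<noteq> \<infinity>" and D: "real (max_degree_sum V X k A) \<le> D"
  shows "ereal (spectral_gap X k) \<le> ereal (D / real (card V)) * cheeger_quotient V X k A"
proof -
  let ?R = "rainbow_completion_faces V X k A" and ?F = "rainbow_faces X k A"
  have "0 < card ?R"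
    using assms(3) by (auto simp: cheeger_quotient_def split: if_splits)
  have "V \<noteq> {}" "finite V"
    using X A by (auto simp: nonempty_partition_def abstract_complex_def)
  then have "0 < card V"
    by (simp add: card_gt_0_iff)
  have "spectral_gap X k * card ?R \<le> max_degree_sum V X k A * card ?F"
    by (rule spectral_gap_mult_card_rainbow_completion_faces_le[OF X A])
  also have "\<dots> \<le> D * card ?F"
    using D by (simp add: mult_right_mono)
  finally show ?thesis
    using \<open>0 < card ?R\<close> \<open>0 < card V\<close> by (simp add: cheeger_quotient_def field_simps)
qed

lemma nonempty_partition_fibres:
  assumes "c ` V = {..k}"
  shows "nonempty_partition V k (\<lambda>i. {v \<in> V. c v = i})"
proof -
  have "{v \<in> V. c v = i} \<noteq> {}" if "i \<le> k" for i
    using assms that by (metis (mono_tags, lifting) atMost_iff empty_Collect_eq imageE)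
  then show ?thesis
    using assms by (auto simp: nonempty_partition_def disjoint_family_on_def)
qed

lemma part_index_fibres: "v \<in> V \<Longrightarrow> part_index (\<lambda>i. {v \<in> V. c v = i}) v = c v"
  by (simp add: part_index_def Least_equality)

lemma rainbow_partition_exists:
  assumes "\<tau> \<subseteq> V" "card \<tau> = k + 1"
  obtains A where "nonempty_partition V k A" "\<forall>i\<le>k. card (\<tau> \<inter> A i) = 1"
proof -
  have "finite \<tau>"
    using assms(2) by (intro card_ge_0_finite) simp
  then obtain e where e: "bij_betw e \<tau> {..k}"
    using finite_same_card_bij[of \<tau> "{..k}"] assms(2) by auto
  define c where "c v = (if v \<in> \<tau> then e v else 0)" for v
  have image: "c ` \<tau> = {..k}"
    using e by (simp add: c_def bij_betw_def)
  then have "c v \<le> k" for v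
    by (cases "v \<in> \<tau>") (auto simp: c_def)
  then have "c ` V = {..k}"
    using image_mono[OF assms(1), of c] by (auto simp: image)
  define A where "A i = {v \<in> V. c v = i}" for i
  have A: "nonempty_partition V k A"
    unfolding A_def by (rule nonempty_partition_fibres[OF \<open>c ` V = {..k}\<close>])
  moreover have "part_index A ` \<tau> = {..k}"
    unfolding image[symmetric] A_def using assms(1) part_index_fibres[of _ V c]
    by (intro image_cong) auto
  ultimately show thesis
    using that rainbow_iff_image_part_index[OF A assms] by blast
qed

lemma cheeger_constant_less_infinity:
  assumes X: "abstract_complex V X" and "k_dimensional X k"
  shows "cheeger_constant V X k < \<infinity>"
proof -
  obtain \<tau> where \<tau>: "\<tau> \<in> X" "card \<tau> = k + 1"
    using assms(2) by (auto simp: k_dimensional_def)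
  have "\<tau> \<subseteq> V" "finite V"
    using X \<tau>(1) by (auto simp: abstract_complex_def)
  then obtain A where A: "nonempty_partition V k A" "\<forall>i\<le>k. card (\<tau> \<inter> A i) = 1"
    using rainbow_partition_exists \<tau>(2) by metis
  have "\<tau> \<in> rainbow_completion_faces V X k A"
    using \<tau> A(2) by (simp add: rainbow_completion_faces_def k_completion_def)
  have "cheeger_constant V X k \<le> cheeger_quotient V X k A"
    unfolding cheeger_constant_def
    using A(1) by (intro Min_le finite_cheeger_quotients \<open>finite V\<close>) auto
  also have "\<dots> < \<infinity>"
    using \<open>\<tau> \<in> rainbow_completion_faces V X k A\<close> cheeger_quotient_eq_infinity_iff[OF X, of k A]
    by auto
  finally show ?thesis .
qed

theorem theorem2:
  fixes V :: "'a::linorder set" and X :: "'a set set" and k :: nat and A :: "nat \<Rightarrow> 'a set"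
  assumes "k \<ge> 1"
    and "abstract_complex V X"
    and "k_dimensional X k"
    and "nonempty_partition V k A"
    and "cheeger_quotient V X k A = cheeger_constant V X k"
  shows "ereal (spectral_gap X k)
           \<le> ereal (real (max_degree_sum V X k A) / real (card V)) * cheeger_constant V X k
    \<and> (\<forall>C::real.
         (\<forall>\<sigma>\<in>ifaces X (int k - 1).
            real (card {\<tau> \<in> ifaces (k_completion V X k) (int k). \<sigma> \<subseteq> \<tau>}) \<le> C)
         \<longrightarrow> real (max_degree_sum V X k A) \<le> (real k + 1) * C
           \<and> ereal (spectral_gap X k)
               \<le> ereal ((real k + 1) * C / real (card V)) * cheeger_constant V X k)"
proof -
  have finite_quotient: "cheeger_quotient V X k A \<noteq> \<infinity>"
    using cheeger_constant_less_infinity[OF assms(2,3)] assms(5) by simp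
  have gap_le: "ereal (spectral_gap X k) \<le> ereal (D / real (card V)) * cheeger_constant V X k"
    if "real (max_degree_sum V X k A) \<le> D" for D
    using spectral_gap_le_cheeger_quotient[OF assms(2,4) finite_quotient that] assms(5) by simp
  have "rainbow_completion_faces V X k A \<noteq> {}"
    using finite_quotient cheeger_quotient_eq_infinity_iff[OF assms(2)] by blast
  then show ?thesis
    using gap_le max_degree_sum_le[OF assms(2)] by blast
qed

end
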